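(* Let $n\ge 1$ and let $i$ be an integer with $\frac{n}{2}<i\le\frac{2n}{3}$. If $f\in U_i(n,3)$ and $f\not\equiv 0$, then $$|f|\ge 2^{3n-4i}\cdot 3^{2i-n}.$$ Moreover, this bound is sharp: for all such $n,i$ there exists $f\in U_i(n,3)$, $f\not\equiv 0$, with $|f|=2^{3n-4i}\cdot 3^{2i-n}$.
   Context: For $q\ge 2$ let $\Sigma_q=\{0,1,\ldots,q-1\}$. The Hamming graph $H(n,q)$ has vertex set $\Sigma_q^n$, and two vertices are adjacent if they differ in exactly one coordinate. The eigenvalues of its adjacency matrix are $\lambda_i(n,q)=n(q-1)-q\cdot i$ for $0\le i\le n$. Let $U_i(n,q)$ be the $\lambda_i(n,q)$-eigenspace, i.e. the space of functions $f:\Sigma_q^n\to\mathbb{R}$ with $\lambda_i(n,q)f(x)=\sum_{y\in N(x)}f(y)$ for every vertex $x$, where $N(x)$ is the set of neighbors of $x$. For a function $f:\Sigma_q^n\to\mathbb{R}$, $|f|$ denotes the cardinality of its support $\{x : f(x)\ne 0\}$. *)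

theory Defs
  imports Complex_Main
begin

definition hamming_verts :: "nat \<Rightarrow> nat \<Rightarrow> nat list set" where
  "hamming_verts n q = {x. set x \<subseteq> {0..<q} \<and> length x = n}"

definition hamming_neighbors :: "nat \<Rightarrow> nat \<Rightarrow> nat list \<Rightarrow> nat list set" where
  "hamming_neighbors n q x =
     {y \<in> hamming_verts n q. card {j \<in> {0..<n}. x ! j \<noteq> y ! j} = 1}"

definition hamming_eigenvalue :: "nat \<Rightarrow> nat \<Rightarrow> nat \<Rightarrow> real" where
  "hamming_eigenvalue n q i = real n * (real q - 1) - real q * real i"

(* A real function on the vertex set is represented by a total function on lists; its values
   off hamming_verts n q are irrelevant, and every notion below ignores them.  In particular,
   being nonzero has to be stated as nonzero at some vertex. *)

definition hamming_eigenspace :: "nat \<Rightarrow> nat \<Rightarrow> nat \<Rightarrow> (nat list \<Rightarrow> real) set" where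
  "hamming_eigenspace n q i =
     {f. \<forall>x \<in> hamming_verts n q.
           hamming_eigenvalue n q i * f x = (\<Sum>y \<in> hamming_neighbors n q x. f y)}"

definition hamming_support :: "nat \<Rightarrow> nat \<Rightarrow> (nat list \<Rightarrow> real) \<Rightarrow> nat list set" where
  "hamming_support n q f = {x \<in> hamming_verts n q. f x \<noteq> 0}"

lemma finite_hamming_verts: "finite (hamming_verts n q)"
  unfolding hamming_verts_def by (rule finite_lists_length_eq) simp

lemma finite_hamming_neighbors: "finite (hamming_neighbors n q x)"
  unfolding hamming_neighbors_def using finite_hamming_verts by simp

lemma finite_hamming_support: "finite (hamming_support n q f)"
  unfolding hamming_support_def using finite_hamming_verts by simp

end

theory Submission
  imports Defs
begin

text \<open>
  On the group of ternary words of length \<open>n\<close>, the complex characters of weight \<open>k\<close> are the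
  eigenvectors that belong to \<open>U\<^sub>k\<close>; the weight is called frequency below.  The lower bound is
  proved by induction on \<open>n\<close>, and since slicing a coordinate does not preserve a single
  eigenspace, it is proved for every nonzero \<open>f\<close> in \<open>U\<^sub>i \<oplus> \<dots> \<oplus> U\<^sub>j\<close> (the predicate \<open>band\<close>):

  \<open>card (supp f) \<ge> M = (8/3)^n (3/2)^i (3/8)^j\<close>  (\<open>support_bound_middle\<close>).

  For \<open>i = j\<close> this is \<open>(8/3)^n (9/16)^i = 2^(3n-4i) 3^(2i-n)\<close>.

  Fix a coordinate and let \<open>f\<^sub>0, f\<^sub>1, f\<^sub>2\<close> be the three slices of \<open>f\<close> there.  A difference of two slices
  has frequencies in \<open>{i-1..j-1}\<close>, so if it is nonzero the induction hypothesis gives it at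
  least \<open>2/3 M\<close> support points.  If some coordinate has three distinct slices, then
  \<open>card (supp f)\<close> is at least half the total over the three differences,
  \<open>1/2 * 3 * 2/3 M = M\<close>.

  Otherwise every coordinate has two equal slices: \<open>f\<close> depends on each coordinate only through
  whether it equals one exceptional letter.  For such functions two further bounds are available,
  each by induction on the head coordinate, and each of the same shape:

  \<open>L = 3^n (4/3)^i (1/3)^j\<close>  (\<open>support_bound_low\<close>, valid for all \<open>f\<close>) and
  \<open>T = (4/3)^n 3^i (3/4)^j\<close>  (\<open>support_bound_two_valued\<close>).

  As \<open>L = (9/8)^(n-i-j) M\<close> and \<open>T = 2^(i+j-n) M\<close>, one of the two is at least \<open>M\<close>, whichever side of
  \<open>n\<close> the sum \<open>i + j\<close> lies on.

  For sharpness write \<open>n = 2p + 3r\<close> and \<open>i = p + 2r\<close> with \<open>p = 2n - 3i\<close> and \<open>r = 2i - n\<close>; both are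
  natural numbers in the given range of \<open>i\<close>.  Eigenvalue indices add and supports multiply under
  tensor products, so \<open>p\<close> copies of an eigenfunction in \<open>U\<^sub>1(2,3)\<close> with four support points and \<open>r\<close>
  copies of one in \<open>U\<^sub>2(3,3)\<close> with six attain the bound \<open>4^p 6^r\<close>.
\<close>

section \<open>Splitting off a coordinate\<close>

lemma Nil_in_verts [simp]: "x \<in> hamming_verts 0 q \<longleftrightarrow> x = []"
  by (auto simp: hamming_verts_def)

lemma Cons_in_verts [simp]:
  "a # x \<in> hamming_verts (Suc n) q \<longleftrightarrow> a < q \<and> x \<in> hamming_verts n q"
  by (auto simp: hamming_verts_def)

lemma verts_Suc_cases:
  assumes "x \<in> hamming_verts (Suc n) q"
  obtains a y where "x = a # y" "a < q" "y \<in> hamming_verts n q"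
  using assms by (cases x) (auto simp: hamming_verts_def)

lemma in_vertsD: "x \<in> hamming_verts n q \<Longrightarrow> length x = n"
  by (simp add: hamming_verts_def)

lemma ex_less_3: "(\<exists>a<3. P (a::nat)) \<longleftrightarrow> P 0 \<or> P 1 \<or> P 2"
  by (auto simp: less_Suc_eq numeral_eq_Suc)

lemma all_less_3: "(\<forall>a<3. P (a::nat)) \<longleftrightarrow> P 0 \<and> P 1 \<and> P 2"
  by (auto simp: less_Suc_eq numeral_eq_Suc)

lemma sum_less_3: "(\<Sum>a<3. g a) = g 0 + g 1 + g (2::nat)" for g :: "nat \<Rightarrow> 'a::comm_monoid_add"
  by (simp add: numeral_eq_Suc add.assoc)

lemma support_Suc:
  "card (hamming_support (Suc n) q f) = (\<Sum>a<q. card (hamming_support n q (\<lambda>x. f (a # x))))"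
proof -
  have "hamming_support (Suc n) q f = (\<Union>a<q. (#) a ` hamming_support n q (\<lambda>x. f (a # x)))"
    by (auto simp: hamming_support_def elim!: verts_Suc_cases)
  also have "card \<dots> = (\<Sum>a<q. card ((#) a ` hamming_support n q (\<lambda>x. f (a # x))))"
    by (rule card_UN_disjoint) (auto intro: finite_hamming_support)
  also have "\<dots> = (\<Sum>a<q. card (hamming_support n q (\<lambda>x. f (a # x))))"
    by (intro sum.cong refl card_image) (simp add: inj_on_def)
  finally show ?thesis .
qed

definition insert_at :: "nat \<Rightarrow> 'a \<Rightarrow> 'a list \<Rightarrow> 'a list" where
  "insert_at k a y = take k y @ a # drop k y"

lemma insert_at_0 [simp]: "insert_at 0 a y = a # y"
  and insert_at_Suc [simp]: "insert_at (Suc k) a (b # y) = b # insert_at k a y"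
  by (simp_all add: insert_at_def)

lemma support_insert_at:
  "k \<le> n \<Longrightarrow> card (hamming_support (Suc n) q f)
     = (\<Sum>a<q. card (hamming_support n q (\<lambda>y. f (insert_at k a y))))"
proof (induction k arbitrary: n f)
  case 0
  show ?case by (simp add: support_Suc)
next
  case (Suc k)
  then obtain m where n: "n = Suc m" and k: "k \<le> m"
    by (cases n) auto
  have "card (hamming_support (Suc n) q f)
      = (\<Sum>b<q. \<Sum>a<q. card (hamming_support m q (\<lambda>y. f (b # insert_at k a y))))"
    by (subst support_Suc) (simp add: n Suc.IH[OF k])
  also have "\<dots> = (\<Sum>a<q. \<Sum>b<q. card (hamming_support m q (\<lambda>y. f (b # insert_at k a y))))"
    by (rule sum.swap)
  also have "\<dots> = (\<Sum>a<q. card (hamming_support n q (\<lambda>y. f (insert_at (Suc k) a y))))"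
    by (simp add: n support_Suc)
  finally show ?case .
qed

lemma support_mono:
  assumes "\<And>x. x \<in> hamming_verts n q \<Longrightarrow> f x \<noteq> 0 \<Longrightarrow> g x \<noteq> 0"
  shows "card (hamming_support n q f) \<le> card (hamming_support n q g)"
  using assms by (intro card_mono finite_hamming_support) (auto simp: hamming_support_def)

lemma support_union_bound:
  assumes "\<And>x. x \<in> hamming_verts n q \<Longrightarrow> h x \<noteq> 0 \<Longrightarrow> f x \<noteq> 0 \<or> g x \<noteq> 0"
  shows "card (hamming_support n q h)
    \<le> card (hamming_support n q f) + card (hamming_support n q g)"
proof -
  have "hamming_support n q h \<subseteq> hamming_support n q f \<union> hamming_support n q g"
    using assms by (auto simp: hamming_support_def)
  then show ?thesis
    by (meson card_Un_le card_mono finite_UnI finite_hamming_support order_trans)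
qed

section \<open>Functions of bounded frequency\<close>

text \<open>
  The functions whose frequencies, i.e. weights of characters, all lie in \<open>{i..j}\<close>.  Splitting the
  head coordinate into its constants and the functions of sum zero turns this into a recursion: the
  first part uses up no weight and is seen by the sum of the slices, the second uses up one and is
  seen by their differences.  The bounds are integers because the recursion takes \<open>i\<close> below zero.
\<close>
primrec band :: "nat \<Rightarrow> int \<Rightarrow> int \<Rightarrow> (nat list \<Rightarrow> real) \<Rightarrow> bool" where
  "band 0 i j f \<longleftrightarrow> f [] = 0 \<or> i \<le> 0 \<and> 0 \<le> j"
| "band (Suc n) i j f \<longleftrightarrow>
     (\<forall>a<3. \<forall>b<3. band n (i - 1) (j - 1) (\<lambda>x. f (a # x) - f (b # x))) \<and>
     band n i j (\<lambda>x. f (0 # x) + f (1 # x) + f (2 # x))"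

lemma band_cong:
  assumes "\<And>x. x \<in> hamming_verts n 3 \<Longrightarrow> f x = g x"
  shows "band n i j f \<longleftrightarrow> band n i j g"
  using assms
proof (induction n arbitrary: i j f g)
  case 0
  then show ?case by simp
next
  case (Suc n)
  have "band n (i - 1) (j - 1) (\<lambda>x. f (a # x) - f (b # x))
      \<longleftrightarrow> band n (i - 1) (j - 1) (\<lambda>x. g (a # x) - g (b # x))" if "a < 3" "b < 3" for a b
    by (rule Suc.IH) (use that Suc.prems in simp)
  moreover have "band n i j (\<lambda>x. f (0 # x) + f (1 # x) + f (2 # x))
      \<longleftrightarrow> band n i j (\<lambda>x. g (0 # x) + g (1 # x) + g (2 # x))"
    by (rule Suc.IH) (use Suc.prems in simp)
  ultimately show ?case by simp
qed

lemma band_lincomb: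
  "band n i j f \<Longrightarrow> band n i j g \<Longrightarrow> band n i j (\<lambda>x. c * f x + d * g x)"
proof (induction n arbitrary: i j f g)
  case 0
  then show ?case by auto
next
  case (Suc n)
  have "band n (i - 1) (j - 1) (\<lambda>x. (c * f (a # x) + d * g (a # x)) - (c * f (b # x) + d * g (b # x)))"
    if "a < 3" "b < 3" for a b
    using Suc.IH[of "i - 1" "j - 1" "\<lambda>x. f (a # x) - f (b # x)" "\<lambda>x. g (a # x) - g (b # x)"]
      Suc.prems that by (simp add: algebra_simps)
  moreover have "band n i j (\<lambda>x. (c * f (0 # x) + d * g (0 # x)) + (c * f (1 # x) + d * g (1 # x))
      + (c * f (2 # x) + d * g (2 # x)))"
    using Suc.IH[of i j "\<lambda>x. f (0 # x) + f (1 # x) + f (2 # x)"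
        "\<lambda>x. g (0 # x) + g (1 # x) + g (2 # x)"]
      Suc.prems by (simp add: algebra_simps)
  ultimately show ?case by simp
qed

lemma band_scale: "band n i j f \<Longrightarrow> band n i j (\<lambda>x. c * f x)"
  using band_lincomb[of n i j f f c 0] by simp

lemma band_mono: "band n i j f \<Longrightarrow> i' \<le> i \<Longrightarrow> j \<le> j' \<Longrightarrow> band n i' j' f"
proof (induction n arbitrary: i j i' j' f)
  case 0
  then show ?case by auto
next
  case (Suc n)
  have "band n (i' - 1) (j' - 1) h" if "band n (i - 1) (j - 1) h" for h
    by (rule Suc.IH[OF that]) (use Suc.prems in auto)
  moreover have "band n i' j' h" if "band n i j h" for h
    by (rule Suc.IH[OF that]) (use Suc.prems in auto)
  ultimately show ?case
    using Suc.prems(1) by simp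
qed

text \<open>
  When two of the slices vanish, the third is both the sum of all slices and a difference of two, so
  that only frequencies in \<open>{i..j-1}\<close> remain.
\<close>
lemma band_inter: "band n i j f \<Longrightarrow> band n i' j' f \<Longrightarrow> band n (max i i') (min j j') f"
proof (induction n arbitrary: i j i' j' f)
  case 0
  then show ?case by auto
next
  case (Suc n)
  have "band n (max i i' - 1) (min j j' - 1) h"
    if "band n (i - 1) (j - 1) h" "band n (i' - 1) (j' - 1) h" for h
  proof -
    have "max i i' - 1 = max (i - 1) (i' - 1)" "min j j' - 1 = min (j - 1) (j' - 1)"
      by auto
    then show ?thesis using Suc.IH[OF that] by simp
  qed
  then show ?case using Suc.IH Suc.prems by simp
qed

text \<open>
  Three times a slice is the sum of all slices plus its differences from each of them, so both
  frequency ranges of the recursion contribute.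
\<close>
lemma band_head:
  assumes "band (Suc n) i j f" "a < 3"
  shows "band n (i - 1) j (\<lambda>x. f (a # x))"
proof -
  let ?d = "\<lambda>b x. f (a # x) - f (b # x)"
  have d: "band n (i - 1) j (?d b)" if "b < 3" for b
    by (rule band_mono[of n "i - 1" "j - 1"]) (use assms that in auto)
  have s: "band n (i - 1) j (\<lambda>x. f (0 # x) + f (1 # x) + f (2 # x))"
    by (rule band_mono[of n i j]) (use assms in auto)
  have "band n (i - 1) j (\<lambda>x. 1/3 * (1 * (f (0 # x) + f (1 # x) + f (2 # x))
      + 1 * (1 * (1 * ?d 0 x + 1 * ?d 1 x) + 1 * ?d 2 x)))"
    by (intro band_scale band_lincomb s d) auto
  then show ?thesis by (simp add: algebra_simps)
qed

text \<open>
  The recursive definition singles out the head, but frequencies do not depend on the order of the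
  coordinates.  Slicing at position \<open>k + 1\<close> commutes with slicing at the head, so the property passes
  from one position to the next.
\<close>
lemma band_insert_at_diff:
  "band (Suc n) i j f \<Longrightarrow> k \<le> n \<Longrightarrow> a < 3 \<Longrightarrow> b < 3 \<Longrightarrow>
    band n (i - 1) (j - 1) (\<lambda>y. f (insert_at k a y) - f (insert_at k b y))"
proof (induction k arbitrary: n i j f)
  case 0
  then show ?case by simp
next
  case (Suc k)
  then obtain m where n: "n = Suc m" and k: "k \<le> m"
    by (cases n) auto
  have "band m (i - 1 - 1) (j - 1 - 1)
      (\<lambda>y. (f (c # insert_at k a y) - f (d # insert_at k a y))
         - (f (c # insert_at k b y) - f (d # insert_at k b y)))" if "c < 3" "d < 3" for c d
    using Suc.IH[of m "i - 1" "j - 1" "\<lambda>y. f (c # y) - f (d # y)"] Suc.prems k n that by simp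
  moreover have "band m (i - 1) (j - 1)
      (\<lambda>y. (f (0 # insert_at k a y) + f (1 # insert_at k a y) + f (2 # insert_at k a y))
         - (f (0 # insert_at k b y) + f (1 # insert_at k b y) + f (2 # insert_at k b y)))"
    using Suc.IH[of m i j "\<lambda>y. f (0 # y) + f (1 # y) + f (2 # y)"] Suc.prems k n by simp
  ultimately show ?case
    by (simp add: n algebra_simps)
qed

section \<open>Eigenfunctions\<close>

text \<open>
  A neighbour changes either a later letter or the head; this yields the recursion for the
  adjacency operator on which all later statements about eigenfunctions rest.
\<close>
lemma hamming_neighbors_Cons:
  assumes c: "c < q" and x: "x \<in> hamming_verts n q"
  shows "hamming_neighbors (Suc n) q (c # x)
    = (#) c ` hamming_neighbors n q x \<union> (\<lambda>b. b # x) ` ({..<q} - {c})"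
proof -
  have dist: "card {j. j < Suc n \<and> (c # x) ! j \<noteq> (b # z) ! j}
      = (if b = c then 0 else 1) + card {j. j < n \<and> x ! j \<noteq> z ! j}" for b z
  proof -
    let ?D = "{j. j < n \<and> x ! j \<noteq> z ! j}"
    have "{j. j < Suc n \<and> (c # x) ! j \<noteq> (b # z) ! j}
        = (if b = c then {} else {0}) \<union> Suc ` ?D" (is "?L = ?R")
    proof (rule set_eqI)
      fix j show "j \<in> ?L \<longleftrightarrow> j \<in> ?R"
        by (cases j) auto
    qed
    then have "card ?L = card (if b = c then {} else {0::nat}) + card (Suc ` ?D)"
      by (simp only:) (rule card_Un_disjoint, auto)
    then show ?thesis
      by (simp add: card_image)
  qed
  have same: "(\<forall>j<n. x ! j = z ! j) \<longleftrightarrow> z = x" if "z \<in> hamming_verts n q" for z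
    using in_vertsD[OF that] in_vertsD[OF x] by (auto simp: list_eq_iff_nth_eq)
  show ?thesis
  proof (intro set_eqI iffI)
    fix y
    assume y: "y \<in> hamming_neighbors (Suc n) q (c # x)"
    then obtain b z where bz: "y = b # z" "b < q" "z \<in> hamming_verts n q"
      by (auto simp: hamming_neighbors_def elim: verts_Suc_cases)
    show "y \<in> (#) c ` hamming_neighbors n q x \<union> (\<lambda>b. b # x) ` ({..<q} - {c})"
      using y bz same[of z]
      by (cases "b = c") (auto simp: hamming_neighbors_def dist)
  next
    fix y
    assume "y \<in> (#) c ` hamming_neighbors n q x \<union> (\<lambda>b. b # x) ` ({..<q} - {c})"
    then show "y \<in> hamming_neighbors (Suc n) q (c # x)"
      using c x by (auto simp: hamming_neighbors_def dist)
  qed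
qed

definition neighbor_sum :: "nat \<Rightarrow> nat \<Rightarrow> (nat list \<Rightarrow> real) \<Rightarrow> nat list \<Rightarrow> real" where
  "neighbor_sum n q f x = (\<Sum>y\<in>hamming_neighbors n q x. f y)"

lemma neighbor_sum_0 [simp]: "neighbor_sum 0 q f x = 0"
  by (simp add: neighbor_sum_def hamming_neighbors_def)

lemma neighbor_sum_Cons:
  assumes "c < q" "x \<in> hamming_verts n q"
  shows "neighbor_sum (Suc n) q f (c # x)
    = neighbor_sum n q (\<lambda>y. f (c # y)) x + (\<Sum>b<q. f (b # x)) - f (c # x)"
proof -
  have "neighbor_sum (Suc n) q f (c # x)
      = (\<Sum>y\<in>(#) c ` hamming_neighbors n q x. f y) + (\<Sum>y\<in>(\<lambda>b. b # x) ` ({..<q} - {c}). f y)"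
    unfolding neighbor_sum_def hamming_neighbors_Cons[OF assms]
    by (rule sum.union_disjoint) (auto intro: finite_hamming_neighbors)
  also have "\<dots> = neighbor_sum n q (\<lambda>y. f (c # y)) x + (\<Sum>b\<in>{..<q} - {c}. f (b # x))"
    by (simp add: sum.reindex inj_on_def neighbor_sum_def)
  also have "(\<Sum>b\<in>{..<q} - {c}. f (b # x)) = (\<Sum>b<q. f (b # x)) - f (c # x)"
    using assms by (simp add: sum_diff1)
  finally show ?thesis by simp
qed

lemma eigenspace_iff:
  "f \<in> hamming_eigenspace n q i \<longleftrightarrow>
    (\<forall>x\<in>hamming_verts n q. neighbor_sum n q f x = hamming_eigenvalue n q i * f x)"
  by (auto simp: hamming_eigenspace_def neighbor_sum_def)

lemma neighbor_sum_linear: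
  "neighbor_sum n q (\<lambda>x. f x + g x) x = neighbor_sum n q f x + neighbor_sum n q g x"
  "neighbor_sum n q (\<lambda>x. f x - g x) x = neighbor_sum n q f x - neighbor_sum n q g x"
  "neighbor_sum n q (\<lambda>x. f x * c) x = neighbor_sum n q f x * c"
  "neighbor_sum n q (\<lambda>x. c * f x) x = c * neighbor_sum n q f x"
  by (simp_all add: neighbor_sum_def sum.distrib sum_subtractf sum_distrib_left sum_distrib_right)

text \<open>
  If \<open>A f = \<lambda> f\<close>, then summing the recursion over the head letters shows that the sum of the slices
  has eigenvalue \<open>\<lambda> - 2\<close> in dimension \<open>n\<close>, and subtracting two instances that a difference
  of slices has eigenvalue \<open>\<lambda> + 1\<close>; these belong to the indices \<open>i\<close> and \<open>i - 1\<close>.  In dimension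
  zero the only vertex has no neighbours, so a nonzero value forces \<open>i = 0\<close>.
\<close>
lemma band_of_eigenvector:
  "(\<And>x. x \<in> hamming_verts n 3 \<Longrightarrow>
      neighbor_sum n 3 f x = (2 * real n - 3 * of_int i) * f x) \<Longrightarrow> band n i i f"
proof (induction n arbitrary: i f)
  case 0
  from 0[of "[]"] show ?case by auto
next
  case (Suc n)
  have eig: "neighbor_sum n 3 (\<lambda>y. f (c # y)) x
      = (2 * real n + 3 - 3 * of_int i) * f (c # x) - (f (0 # x) + f (1 # x) + f (2 # x))"
    if "c < 3" "x \<in> hamming_verts n 3" for c x
    using Suc.prems[of "c # x"] neighbor_sum_Cons[OF that, of f] that
    by (simp add: sum_less_3 algebra_simps)
  have "band n (i - 1) (i - 1) (\<lambda>x. f (a # x) - f (b # x))" if "a < 3" "b < 3" for a b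
    by (rule Suc.IH) (simp add: neighbor_sum_linear eig that algebra_simps)
  moreover have "band n i i (\<lambda>x. f (0 # x) + f (1 # x) + f (2 # x))"
    by (rule Suc.IH) (simp add: neighbor_sum_linear eig algebra_simps)
  ultimately show ?case by simp
qed

lemma eigenspace_imp_band:
  "f \<in> hamming_eigenspace n 3 i \<Longrightarrow> band n (int i) (int i) f"
  by (rule band_of_eigenvector)
     (simp add: eigenspace_iff hamming_eigenvalue_def algebra_simps)

section \<open>Lower bounds\<close>

lemma support_0: "card (hamming_support 0 q f) = (if f [] = 0 then 0 else 1)"
proof -
  have "hamming_support 0 q f = (if f [] = 0 then {} else {[]})"
    by (auto simp: hamming_support_def)
  then show ?thesis by simp
qed

text \<open>
  The base case of the three inductions below: in dimension zero a nonzero function has support of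
  size one and satisfies \<open>i \<le> 0 \<le> j\<close>.
\<close>
lemma powi_le_one_of_signs:
  fixes a b :: real
  assumes "1 \<le> a" "0 < b" "b \<le> 1" "i \<le> 0" "0 \<le> j"
  shows "a powi i * b powi j \<le> 1"
proof -
  have "a powi i \<le> a powi 0"
    using assms by (intro power_int_increasing) auto
  moreover have "b powi j \<le> b powi 0"
    using assms by (intro power_int_decreasing) auto
  ultimately show ?thesis
    using assms by (intro mult_le_one) auto
qed

text \<open>
  Let \<open>G\<close> be the bound in dimension \<open>n + 1\<close>.  The induction hypothesis gives a nonzero function in dimension \<open>n\<close>
  at least \<open>G/4\<close> support points if it is a slice, \<open>3G/4\<close> if it is a difference of slices, \<open>G/3\<close> if its
  frequencies lie in \<open>{i..j}\<close>, and \<open>G\<close> if they lie in \<open>{i..j-1}\<close>.  Three distinct slices thus have together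
  at least \<open>9G/8\<close>, three equal ones \<open>3 * G/3\<close>.  If exactly two agree and are nonzero, one of
  them together with the third accounts for \<open>3G/4\<close> and the other for \<open>G/4\<close>.  If the two vanish, the third
  slice has frequencies in \<open>{i..j-1}\<close>.
\<close>
lemma support_bound_low:
  "band n i j f \<Longrightarrow> \<exists>x\<in>hamming_verts n 3. f x \<noteq> 0 \<Longrightarrow>
    3 ^ n * ((4/3) powi i * (1/3) powi j) \<le> real (card (hamming_support n 3 f))"
proof (induction n arbitrary: i j f)
  case 0
  then show ?case
    using powi_le_one_of_signs[of "4/3" "1/3" i j] by (auto simp: support_0)
next
  case (Suc n)
  define G :: real where "G = 3 ^ Suc n * ((4/3) powi i * (1/3) powi j)"
  define w where "w a = real (card (hamming_support n 3 (\<lambda>x. f (a # x))))" for a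
  have total: "real (card (hamming_support (Suc n) 3 f)) = w 0 + w 1 + w 2"
    by (simp add: support_Suc sum_less_3 w_def)
  have G: "0 \<le> G" by (simp add: G_def)
  have slice: "G / 4 \<le> w a" if "a < 3" "\<exists>x\<in>hamming_verts n 3. f (a # x) \<noteq> 0" for a
    using Suc.IH[OF band_head[OF Suc.prems(1) that(1)] that(2)]
    by (simp add: G_def w_def power_int_diff)
  have diff: "3 / 4 * G \<le> w a + w b"
    if "a < 3" "b < 3" "\<exists>x\<in>hamming_verts n 3. f (a # x) \<noteq> f (b # x)" for a b
  proof -
    have "3 / 4 * G \<le> real (card (hamming_support n 3 (\<lambda>x. f (a # x) - f (b # x))))"
      using Suc.IH[of "i - 1" "j - 1" "\<lambda>x. f (a # x) - f (b # x)"] Suc.prems that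
      by (simp add: G_def power_int_diff)
    also have "\<dots> \<le> w a + w b"
      unfolding w_def of_nat_add[symmetric] of_nat_le_iff by (rule support_union_bound) auto
    finally show ?thesis .
  qed
  have two_equal: "G \<le> w a + w b + w c"
    if abc: "(a, b, c) \<in> {(0, 1, 2), (0, 2, 1), (1, 2, 0)}"
      and eq: "\<forall>x\<in>hamming_verts n 3. f (a # x) = f (b # x)" for a b c
  proof -
    have lt: "a < 3" "b < 3" "c < 3" using abc by auto
    have sum: "band n i j (\<lambda>x. f (a # x) + f (b # x) + f (c # x))"
      using Suc.prems(1) abc by (auto simp: algebra_simps)
    have dif: "band n (i - 1) (j - 1) (\<lambda>x. f (c # x) - f (a # x))"
      using Suc.prems(1) lt by simp
    have wab: "w a = w b"
      unfolding w_def of_nat_eq_iff by (intro antisym support_mono) (use eq in auto)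
    consider (zero) "\<forall>x\<in>hamming_verts n 3. f (a # x) = 0"
      | (same) "\<exists>x\<in>hamming_verts n 3. f (a # x) \<noteq> 0" "\<forall>x\<in>hamming_verts n 3. f (a # x) = f (c # x)"
      | (differ) "\<exists>x\<in>hamming_verts n 3. f (a # x) \<noteq> 0" "\<exists>x\<in>hamming_verts n 3. f (a # x) \<noteq> f (c # x)"
      by blast
    then show ?thesis
    proof cases
      case zero
      have "band n i j (\<lambda>x. f (c # x))"
        using sum by (rule iffD1[OF band_cong, rotated]) (use zero eq in auto)
      moreover have "band n (i - 1) (j - 1) (\<lambda>x. f (c # x))"
        using dif by (rule iffD1[OF band_cong, rotated]) (use zero in auto)
      ultimately have "band n i (j - 1) (\<lambda>x. f (c # x))"
        using band_inter[of n i j "\<lambda>x. f (c # x)" "i - 1" "j - 1"] by simp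
      moreover have "\<exists>x\<in>hamming_verts n 3. f (c # x) \<noteq> 0"
      proof (rule ccontr)
        assume "\<not> ?thesis"
        moreover obtain x where "x \<in> hamming_verts (Suc n) 3" "f x \<noteq> 0"
          using Suc.prems(2) by blast
        moreover from this obtain d y where "x = d # y" "d < 3" "y \<in> hamming_verts n 3"
          by (elim verts_Suc_cases)
        ultimately show False
          using zero eq abc by (auto simp: less_Suc_eq numeral_eq_Suc)
      qed
      ultimately have "G \<le> w c"
        using Suc.IH[of i "j - 1" "\<lambda>x. f (c # x)"]
        by (simp add: G_def w_def power_int_diff)
      then show ?thesis by (simp add: w_def)
    next
      case same
      have "band n i j (\<lambda>x. 3 * f (a # x))"
        using sum by (rule iffD1[OF band_cong, rotated]) (use same eq in auto)
      then have "band n i j (\<lambda>x. f (a # x))"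
        using band_scale[of n i j "\<lambda>x. 3 * f (a # x)" "1/3"] by simp
      then have "G / 3 \<le> w a"
        using Suc.IH[of i j "\<lambda>x. f (a # x)"] same(1) by (simp add: G_def w_def)
      moreover have "w a = w c"
        unfolding w_def of_nat_eq_iff by (intro antisym support_mono) (use same in auto)
      ultimately show ?thesis using wab by simp
    next
      case differ
      then show ?thesis
        using slice[of a] diff[of a c] lt wab by fastforce
    qed
  qed
  consider "\<forall>x\<in>hamming_verts n 3. f (0 # x) = f (1 # x)"
    | "\<forall>x\<in>hamming_verts n 3. f (0 # x) = f (2 # x)"
    | "\<forall>x\<in>hamming_verts n 3. f (1 # x) = f (2 # x)"
    | (distinct) "\<exists>x\<in>hamming_verts n 3. f (0 # x) \<noteq> f (1 # x)"
        "\<exists>x\<in>hamming_verts n 3. f (0 # x) \<noteq> f (2 # x)"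
        "\<exists>x\<in>hamming_verts n 3. f (1 # x) \<noteq> f (2 # x)"
    by blast
  then have "G \<le> w 0 + w 1 + w 2"
  proof cases
    case distinct
    then show ?thesis
      using diff[OF _ _ distinct(1)] diff[OF _ _ distinct(2)] diff[OF _ _ distinct(3)] G by simp
  qed (use two_equal[of 0 1 2] two_equal[of 0 2 1] two_equal[of 1 2 0] in simp_all)
  then show ?case
    unfolding total G_def[symmetric] .
qed

text \<open>
  The exceptional letter \<open>e k\<close> may vary with the position but is a parameter rather than
  quantified existentially, so that functions with the same \<open>e\<close> form a vector space.
\<close>
definition two_valued_coords :: "nat \<Rightarrow> (nat \<Rightarrow> nat) \<Rightarrow> (nat list \<Rightarrow> real) \<Rightarrow> bool" where
  "two_valued_coords n e f \<longleftrightarrow> (\<forall>k<n. \<forall>y\<in>hamming_verts (n - 1) 3. \<forall>s<3. \<forall>t<3.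
     s \<noteq> e k \<longrightarrow> t \<noteq> e k \<longrightarrow> f (insert_at k s y) = f (insert_at k t y))"

lemma two_valued_coords_head:
  assumes "two_valued_coords (Suc n) e f" "a < 3"
  shows "two_valued_coords n (e \<circ> Suc) (\<lambda>x. f (a # x))"
  unfolding two_valued_coords_def
proof (intro allI ballI impI)
  fix k y s t
  assume *: "k < n" "y \<in> hamming_verts (n - 1) 3" "s < (3::nat)" "t < (3::nat)"
    "s \<noteq> (e \<circ> Suc) k" "t \<noteq> (e \<circ> Suc) k"
  then have "a # y \<in> hamming_verts n 3"
    using assms(2) by (cases n) auto
  then have "f (insert_at (Suc k) s (a # y)) = f (insert_at (Suc k) t (a # y))"
    using * assms(1)[unfolded two_valued_coords_def, rule_format, of "Suc k" "a # y" s t] by simp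
  then show "f (a # insert_at k s y) = f (a # insert_at k t y)"
    by simp
qed

lemma two_valued_coords_lincomb:
  assumes "two_valued_coords n e f" "two_valued_coords n e g"
  shows "two_valued_coords n e (\<lambda>x. c * f x + d * g x)"
  unfolding two_valued_coords_def
proof (intro allI ballI impI)
  fix k y s t
  assume *: "k < n" "y \<in> hamming_verts (n - 1) 3" "s < (3::nat)" "t < (3::nat)" "s \<noteq> e k" "t \<noteq> e k"
  show "c * f (insert_at k s y) + d * g (insert_at k s y)
      = c * f (insert_at k t y) + d * g (insert_at k t y)"
    using assms(1)[unfolded two_valued_coords_def, rule_format, OF *]
      assms(2)[unfolded two_valued_coords_def, rule_format, OF *] by simp
qed

text \<open>
  With equal slices \<open>g\<^sub>0, g\<^sub>0\<close> and a third slice \<open>g\<^sub>1\<close>, the induction uses the sum \<open>2 g\<^sub>0 + g\<^sub>1\<close> where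
  the proof of \<open>support_bound_low\<close> uses the difference.  Let \<open>G\<close> be the bound in dimension \<open>n + 1\<close>.
  If \<open>g\<^sub>0\<close> and the sum are nonzero, then \<open>g\<^sub>0\<close> and \<open>g\<^sub>1\<close> account for \<open>3G/4\<close>
  support points, and the second copy of \<open>g\<^sub>0\<close> for \<open>G/4\<close>.  If the sum vanishes, then
  \<open>g\<^sub>1 = -2 g\<^sub>0\<close>, so \<open>g\<^sub>0\<close> is a multiple of a difference of slices and each of the three slices has
  \<open>G/3\<close>.  If \<open>g\<^sub>0\<close> vanishes, then \<open>g\<^sub>1\<close> has frequencies in \<open>{i..j-1}\<close>, which gives \<open>G\<close>.
\<close>
lemma support_bound_two_valued:
  "band n i j f \<Longrightarrow> \<exists>x\<in>hamming_verts n 3. f x \<noteq> 0 \<Longrightarrow> two_valued_coords n e f \<Longrightarrow>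
    \<forall>k<n. e k < 3 \<Longrightarrow>
    (4/3) ^ n * (3 powi i * (3/4) powi j) \<le> real (card (hamming_support n 3 f))"
proof (induction n arbitrary: i j e f)
  case 0
  then show ?case
    using powi_le_one_of_signs[of 3 "3/4" i j] by (auto simp: support_0)
next
  case (Suc n)
  define G :: real where "G = (4/3) ^ Suc n * (3 powi i * (3/4) powi j)"
  define w where "w a = real (card (hamming_support n 3 (\<lambda>x. f (a # x))))" for a
  define c where "c = e 0"
  have "c < 3" using Suc.prems(4) by (auto simp: c_def)
  then obtain a b :: nat where abc: "(a, b, c) \<in> {(0, 1, 2), (0, 2, 1), (1, 2, 0)}"
    by (auto simp: less_Suc_eq numeral_eq_Suc)
  have lt: "a < 3" "b < 3" "c < 3" using abc by auto
  have eq: "\<forall>x\<in>hamming_verts n 3. f (a # x) = f (b # x)"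
  proof
    fix x assume "x \<in> hamming_verts n 3"
    then have "f (insert_at 0 a x) = f (insert_at 0 b x)"
      using Suc.prems(3)[unfolded two_valued_coords_def, rule_format, of 0 x a b] abc
      by (auto simp: c_def)
    then show "f (a # x) = f (b # x)" by simp
  qed
  have total: "real (card (hamming_support (Suc n) 3 f)) = w a + w b + w c"
    using abc by (auto simp: support_Suc sum_less_3 w_def)
  have wab: "w a = w b"
    unfolding w_def of_nat_eq_iff by (intro antisym support_mono) (use eq in auto)
  define d where "d = e \<circ> Suc"
  have "\<forall>k<n. d k < 3"
    using Suc.prems(4) by (auto simp: d_def)
  note IH = Suc.IH[where e = d, OF _ _ _ this]
  note head = two_valued_coords_head[OF Suc.prems(3), folded d_def]
  have sum: "band n i j (\<lambda>x. 2 * f (a # x) + 1 * f (c # x))"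
  proof -
    have "band n i j (\<lambda>x. f (a # x) + f (b # x) + f (c # x))"
      using Suc.prems(1) abc by (auto simp: algebra_simps)
    then show ?thesis
      by (rule iffD1[OF band_cong, rotated]) (use eq in auto)
  qed
  have dif: "band n (i - 1) (j - 1) (\<lambda>x. f (c # x) - f (a # x))"
    using Suc.prems(1) lt by simp
  consider (zero) "\<forall>x\<in>hamming_verts n 3. f (a # x) = 0"
    | (cancel) "\<exists>x\<in>hamming_verts n 3. f (a # x) \<noteq> 0" "\<forall>x\<in>hamming_verts n 3. 2 * f (a # x) + 1 * f (c # x) = 0"
    | (main) "\<exists>x\<in>hamming_verts n 3. f (a # x) \<noteq> 0" "\<exists>x\<in>hamming_verts n 3. 2 * f (a # x) + 1 * f (c # x) \<noteq> 0"
    by blast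
  then have "G \<le> w a + w b + w c"
  proof cases
    case zero
    have "band n i j (\<lambda>x. f (c # x))"
      using sum by (rule iffD1[OF band_cong, rotated]) (use zero eq in auto)
    moreover have "band n (i - 1) (j - 1) (\<lambda>x. f (c # x))"
      using dif by (rule iffD1[OF band_cong, rotated]) (use zero in auto)
    ultimately have "band n i (j - 1) (\<lambda>x. f (c # x))"
      using band_inter[of n i j "\<lambda>x. f (c # x)" "i - 1" "j - 1"] by simp
    moreover have "\<exists>x\<in>hamming_verts n 3. f (c # x) \<noteq> 0"
    proof (rule ccontr)
      assume "\<not> ?thesis"
      moreover obtain x where "x \<in> hamming_verts (Suc n) 3" "f x \<noteq> 0"
        using Suc.prems(2) by blast
      moreover from this obtain d y where "x = d # y" "d < 3" "y \<in> hamming_verts n 3"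
        by (elim verts_Suc_cases)
      ultimately show False
        using zero eq abc by (auto simp: less_Suc_eq numeral_eq_Suc)
    qed
    ultimately have "G \<le> w c"
      using IH[of i "j - 1" "\<lambda>x. f (c # x)"] head[OF lt(3)]
      by (simp add: G_def w_def power_int_diff)
    then show ?thesis by (simp add: w_def)
  next
    case cancel
    have "band n (i - 1) (j - 1) (\<lambda>x. - 3 * f (a # x))"
      using dif by (rule iffD1[OF band_cong, rotated]) (use cancel in fastforce)
    then have "band n (i - 1) (j - 1) (\<lambda>x. f (a # x))"
      using band_scale[of n "i - 1" "j - 1" "\<lambda>x. - 3 * f (a # x)" "- 1/3"] by simp
    then have "G / 3 \<le> w a"
      using IH[of "i - 1" "j - 1" "\<lambda>x. f (a # x)"] cancel(1) head[OF lt(1)]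
      by (simp add: G_def w_def power_int_diff)
    moreover have "w a \<le> w c"
      unfolding w_def of_nat_le_iff by (intro support_mono) (use cancel in auto)
    ultimately show ?thesis using wab by simp
  next
    case main
    have "3 / 4 * G \<le> real (card (hamming_support n 3 (\<lambda>x. 2 * f (a # x) + 1 * f (c # x))))"
      using IH[OF sum main(2) two_valued_coords_lincomb[OF head[OF lt(1)] head[OF lt(3)]]]
      by (simp add: G_def mult_ac)
    also have "\<dots> \<le> w a + w c"
      unfolding w_def of_nat_add[symmetric] of_nat_le_iff by (rule support_union_bound) auto
    finally have "3 / 4 * G \<le> w a + w c" .
    moreover have "G / 4 \<le> w a"
      using IH[OF band_head[OF Suc.prems(1) lt(1)] main(1) head[OF lt(1)]]
      by (simp add: G_def w_def power_int_diff mult_ac)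
    ultimately show ?thesis using wab by simp
  qed
  then show ?case
    unfolding total G_def[symmetric] .
qed

lemma middle_to_low:
  "(8/3) ^ n * ((3/2) powi i * (3/8) powi j) * (9/8) powi (int n - i - j)
    = (3 ^ n * ((4/3) powi i * (1/3) powi j) :: real)"
proof -
  have "3 ^ n = ((8/3) ^ n * (9/8) ^ n :: real)"
    by (simp flip: power_mult_distrib)
  moreover have "(3/2) powi i = (4/3) powi i * (9/8 :: real) powi i"
    "(3/8) powi j = (1/3) powi j * (9/8 :: real) powi j"
    by (simp_all flip: power_int_mult_distrib)
  moreover have "(9/8 :: real) powi (int n - i - j) = (9/8) ^ n / ((9/8) powi i * (9/8) powi j)"
    by (simp add: power_int_diff)
  ultimately show ?thesis
    by (simp only:) simp
qed

lemma middle_to_two_valued: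
  "(8/3) ^ n * ((3/2) powi i * (3/8) powi j) * 2 powi (i + j - int n)
    = ((4/3) ^ n * (3 powi i * (3/4) powi j) :: real)"
proof -
  have "(8/3) ^ n = (4/3) ^ n * (2 ^ n :: real)"
    by (simp flip: power_mult_distrib)
  moreover have "3 powi i = (3/2) powi i * (2 :: real) powi i"
    "(3/4) powi j = (3/8) powi j * (2 :: real) powi j"
    by (simp_all flip: power_int_mult_distrib)
  moreover have "(2 :: real) powi (i + j - int n) = 2 powi i * 2 powi j / 2 ^ n"
    by (simp add: power_int_diff power_int_add)
  ultimately show ?thesis
    by (simp only:) simp
qed

text \<open>
  A coordinate with three distinct slices closes the induction step, because \<open>(3/8) (2/3) (8/3) = 2/3\<close>
  is the share of each difference.  If there is none, the exceptional letters can be chosen in all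
  coordinates and the bound follows from the other two without the induction hypothesis.
\<close>
lemma support_bound_middle:
  "band n i j f \<Longrightarrow> \<exists>x\<in>hamming_verts n 3. f x \<noteq> 0 \<Longrightarrow>
    (8/3) ^ n * ((3/2) powi i * (3/8) powi j) \<le> real (card (hamming_support n 3 f))"
proof (induction n arbitrary: i j f)
  case 0
  then show ?case
    using powi_le_one_of_signs[of "3/2" "3/8" i j] by (auto simp: support_0)
next
  case (Suc n)
  define G :: real where "G = (8/3) ^ Suc n * ((3/2) powi i * (3/8) powi j)"
  have G: "0 \<le> G" by (simp add: G_def)
  define equal where "equal k a b \<longleftrightarrow>
    (\<forall>y\<in>hamming_verts n 3. f (insert_at k a y) = f (insert_at k b y))" for k a b
  show ?case
  proof (cases "\<exists>k\<le>n. \<not> equal k 0 1 \<and> \<not> equal k 0 2 \<and> \<not> equal k 1 2")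
    case True
    then obtain k where k: "k \<le> n" "\<not> equal k 0 1" "\<not> equal k 0 2" "\<not> equal k 1 2"
      by blast
    define w where "w a = real (card (hamming_support n 3 (\<lambda>y. f (insert_at k a y))))" for a
    have diff: "2 / 3 * G \<le> w a + w b" if "a < 3" "b < 3" "\<not> equal k a b" for a b
    proof -
      have "2 / 3 * G \<le> real (card (hamming_support n 3 (\<lambda>y. f (insert_at k a y) - f (insert_at k b y))))"
        using Suc.IH[OF band_insert_at_diff[OF Suc.prems(1) k(1) that(1,2)]] that(3)
        by (simp add: G_def power_int_diff equal_def)
      also have "\<dots> \<le> w a + w b"
        unfolding w_def of_nat_add[symmetric] of_nat_le_iff by (rule support_union_bound) auto
      finally show ?thesis .
    qed
    have "real (card (hamming_support (Suc n) 3 f)) = w 0 + w 1 + w 2"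
      by (simp add: support_insert_at[OF k(1)] sum_less_3 w_def)
    then show ?thesis
      unfolding G_def[symmetric] using diff[of 0 1] diff[of 0 2] diff[of 1 2] k by simp
  next
    case False
    have "\<exists>c<3. \<forall>s<3. \<forall>t<3. s \<noteq> c \<longrightarrow> t \<noteq> c \<longrightarrow> equal k s t" if "k < Suc n" for k
    proof -
      have "equal k 0 1 \<or> equal k 0 2 \<or> equal k 1 2"
        using False that by auto
      moreover have "equal k s s" "equal k s t \<longleftrightarrow> equal k t s" for s t
        by (auto simp: equal_def)
      ultimately show ?thesis
        unfolding ex_less_3 all_less_3 by simp metis
    qed
    then obtain e where e: "\<forall>k<Suc n. e k < 3 \<and>
        (\<forall>s<3. \<forall>t<3. s \<noteq> e k \<longrightarrow> t \<noteq> e k \<longrightarrow> equal k s t)"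
      by metis
    have cls: "two_valued_coords (Suc n) e f" "\<forall>k<Suc n. e k < 3"
      unfolding two_valued_coords_def using e[unfolded equal_def] by (metis diff_Suc_1, metis)
    show ?thesis
    proof (cases "i + j \<le> int (Suc n)")
      case True
      have "1 \<le> (9/8 :: real) powi (int (Suc n) - i - j)"
        using True by (intro one_le_power_int) auto
      then have "G \<le> G * (9/8) powi (int (Suc n) - i - j)"
        using G mult_left_mono[of 1 _ G] by simp
      also have "\<dots> = 3 ^ Suc n * ((4/3) powi i * (1/3) powi j)"
        unfolding G_def by (rule middle_to_low)
      also have "\<dots> \<le> real (card (hamming_support (Suc n) 3 f))"
        by (rule support_bound_low[OF Suc.prems])
      finally show ?thesis unfolding G_def .
    next
      case False
      have "1 \<le> (2 :: real) powi (i + j - int (Suc n))"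
        using False by (intro one_le_power_int) auto
      then have "G \<le> G * 2 powi (i + j - int (Suc n))"
        using G mult_left_mono[of 1 _ G] by simp
      also have "\<dots> = (4/3) ^ Suc n * (3 powi i * (3/4) powi j)"
        unfolding G_def by (rule middle_to_two_valued)
      also have "\<dots> \<le> real (card (hamming_support (Suc n) 3 f))"
        by (rule support_bound_two_valued[OF Suc.prems cls])
      finally show ?thesis unfolding G_def .
    qed
  qed
qed

section \<open>Sharpness\<close>

definition tensor :: "nat \<Rightarrow> (nat list \<Rightarrow> real) \<Rightarrow> (nat list \<Rightarrow> real) \<Rightarrow> nat list \<Rightarrow> real" where
  "tensor m f g x = f (take m x) * g (drop m x)"

lemma tensor_0: "tensor 0 f g x = f [] * g x"
  and tensor_Suc: "tensor (Suc m) f g (a # x) = tensor m (\<lambda>y. f (a # y)) g x"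
  by (simp_all add: tensor_def)

text \<open>
  The adjacency operator of a Cartesian product of graphs acts as a derivation on tensors; this is
  why eigenvalues add.
\<close>
lemma neighbor_sum_tensor:
  "x \<in> hamming_verts (m + n) q \<Longrightarrow> neighbor_sum (m + n) q (tensor m f g) x
    = tensor m (neighbor_sum m q f) g x + tensor m f (neighbor_sum n q g) x"
proof (induction m arbitrary: f x)
  case 0
  then show ?case by (simp add: tensor_def neighbor_sum_linear)
next
  case (Suc m)
  then obtain c y where x: "x = c # y" "c < q" "y \<in> hamming_verts (m + n) q"
    by (auto elim: verts_Suc_cases)
  have "take m y \<in> hamming_verts m q"
    using x(3) by (auto simp: hamming_verts_def dest: in_set_takeD)
  then show ?case
    using x Suc.IH[OF x(3)]
    by (simp add: neighbor_sum_Cons tensor_Suc)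
       (simp add: tensor_def neighbor_sum_Cons sum_distrib_left algebra_simps)
qed

lemma eigenspace_tensor:
  assumes "f \<in> hamming_eigenspace m q i" "g \<in> hamming_eigenspace n q j"
  shows "tensor m f g \<in> hamming_eigenspace (m + n) q (i + j)"
  unfolding eigenspace_iff
proof
  fix x assume x: "x \<in> hamming_verts (m + n) q"
  then have "take m x \<in> hamming_verts m q" "drop m x \<in> hamming_verts n q"
    by (auto simp: hamming_verts_def dest: in_set_takeD in_set_dropD)
  then show "neighbor_sum (m + n) q (tensor m f g) x
      = hamming_eigenvalue (m + n) q (i + j) * tensor m f g x"
    using assms unfolding neighbor_sum_tensor[OF x] eigenspace_iff tensor_def
    by (simp only:) (simp add: hamming_eigenvalue_def algebra_simps)
qed

lemma support_tensor:
  "card (hamming_support (m + n) q (tensor m f g))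
    = card (hamming_support m q f) * card (hamming_support n q g)"
proof (induction m arbitrary: f)
  case 0
  then show ?case
    by (cases "f [] = 0") (simp_all add: support_0 tensor_def, simp_all add: hamming_support_def)
next
  case (Suc m)
  then show ?case
    by (simp add: support_Suc tensor_Suc sum_distrib_right)
qed

definition axes_difference :: "nat list \<Rightarrow> real" where
  "axes_difference x = of_bool (x ! 0 = 0) - of_bool (x ! 1 = 0)"

lemma eigenspace_axes_difference: "axes_difference \<in> hamming_eigenspace 2 3 1"
  unfolding eigenspace_iff
proof
  fix x assume "x \<in> hamming_verts 2 3"
  then obtain a b where x: "x = [a, b]" and lt: "a < 3" "b < 3"
    by (auto simp: numeral_2_eq_2 elim!: verts_Suc_cases)
  have "neighbor_sum (Suc (Suc 0)) 3 axes_difference [a, b] = hamming_eigenvalue 2 3 1 * axes_difference [a, b]"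
    using lt by (simp add: neighbor_sum_Cons sum_less_3 axes_difference_def hamming_eigenvalue_def)
  then show "neighbor_sum 2 3 axes_difference x = hamming_eigenvalue 2 3 1 * axes_difference x"
    by (simp only: x numeral_2_eq_2)
qed

lemma support_axes_difference: "card (hamming_support 2 3 axes_difference) = 4"
proof -
  have "card (hamming_support (Suc (Suc 0)) 3 axes_difference) = 4"
    by (simp add: support_Suc sum_less_3 support_0 axes_difference_def)
  then show ?thesis
    by (simp only: numeral_2_eq_2)
qed

text \<open>
  A scalar multiple of the sign of a permutation, extended by zero to words with a repeated letter.
  The eigenvalue in question is zero: a word with exactly two distinct letters has two neighbours in
  the support, which differ by a transposition, and all other words have none.
\<close>
definition vandermonde :: "nat list \<Rightarrow> real" where
  "vandermonde x = (real (x ! 1) - real (x ! 0)) * (real (x ! 2) - real (x ! 1)) * (real (x ! 2) - real (x ! 0))"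

lemma eigenspace_vandermonde: "vandermonde \<in> hamming_eigenspace 3 3 2"
  unfolding eigenspace_iff
proof
  fix x assume "x \<in> hamming_verts 3 3"
  then have "x \<in> hamming_verts (Suc (Suc (Suc 0))) 3"
    by (simp add: hamming_verts_def)
  then obtain a b c where x: "x = [a, b, c]" and lt: "a < 3" "b < 3" "c < 3"
    by (auto elim!: verts_Suc_cases)
  have "neighbor_sum (Suc (Suc (Suc 0))) 3 vandermonde [a, b, c] = 0"
    using lt by (simp add: neighbor_sum_Cons sum_less_3 vandermonde_def algebra_simps)
  then have "neighbor_sum 3 3 vandermonde x = 0"
    by (simp only: x numeral_3_eq_3)
  then show "neighbor_sum 3 3 vandermonde x = hamming_eigenvalue 3 3 2 * vandermonde x"
    by (simp add: hamming_eigenvalue_def)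
qed

lemma support_vandermonde: "card (hamming_support 3 3 vandermonde) = 6"
proof -
  have "card (hamming_support (Suc (Suc (Suc 0))) 3 vandermonde) = 6"
    by (simp add: support_Suc sum_less_3 support_0 vandermonde_def)
  then show ?thesis
    by (simp only: numeral_3_eq_3)
qed

lemma exists_tensor_eigenfunction:
  "\<exists>f\<in>hamming_eigenspace (2 * p + 3 * r) 3 (p + 2 * r).
     card (hamming_support (2 * p + 3 * r) 3 f) = 4 ^ p * 6 ^ r"
proof (induction p)
  case 0
  show ?case
  proof (induction r)
    case 0
    have "(\<lambda>_. 1) \<in> hamming_eigenspace 0 3 0"
      by (simp add: eigenspace_iff hamming_eigenvalue_def)
    then show ?case by (intro bexI[of _ "\<lambda>_. 1"]) (simp_all add: support_0)
  next
    case (Suc r)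
    then obtain f where "f \<in> hamming_eigenspace (3 * r) 3 (2 * r)"
      "card (hamming_support (3 * r) 3 f) = 6 ^ r" by auto
    then show ?case
      using eigenspace_tensor[OF eigenspace_vandermonde, of f "3 * r" "2 * r"]
        support_tensor[of 3 "3 * r" 3 vandermonde f] support_vandermonde
      by (intro bexI[of _ "tensor 3 vandermonde f"]) auto
  qed
next
  case (Suc p)
  then obtain f where "f \<in> hamming_eigenspace (2 * p + 3 * r) 3 (p + 2 * r)"
    "card (hamming_support (2 * p + 3 * r) 3 f) = 4 ^ p * 6 ^ r" by auto
  then show ?case
    using eigenspace_tensor[OF eigenspace_axes_difference, of f "2 * p + 3 * r" "p + 2 * r"]
      support_tensor[of 2 "2 * p + 3 * r" 3 axes_difference f] support_axes_difference
    by (intro bexI[of _ "tensor 2 axes_difference f"]) auto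
qed

section \<open>The minimum support\<close>

theorem corollary1:
  fixes n i :: nat
  assumes "n \<ge> 1"
    and "real n / 2 < real i"
    and "real i \<le> 2 * real n / 3"
  shows "(\<forall>f \<in> hamming_eigenspace n 3 i. (\<exists>x \<in> hamming_verts n 3. f x \<noteq> 0) \<longrightarrow>
            card (hamming_support n 3 f) \<ge> 2 ^ (3 * n - 4 * i) * 3 ^ (2 * i - n))
       \<and> (\<exists>f \<in> hamming_eigenspace n 3 i. (\<exists>x \<in> hamming_verts n 3. f x \<noteq> 0) \<and>
            card (hamming_support n 3 f) = 2 ^ (3 * n - 4 * i) * 3 ^ (2 * i - n))"
proof -
  define p where "p = 2 * n - 3 * i"
  define r where "r = 2 * i - n"
  have le: "3 * i \<le> 2 * n" "n \<le> 2 * i"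
    using assms by linarith+
  have n: "n = 2 * p + 3 * r" and i: "i = p + 2 * r"
    using le by (simp_all add: p_def r_def)
  have "(2::nat) ^ (3 * n - 4 * i) * 3 ^ (2 * i - n) = 2 ^ (2 * p + r) * 3 ^ r"
    by (simp add: n i)
  also have "\<dots> = 4 ^ p * 6 ^ r"
    by (simp add: power_add power_mult flip: power_mult_distrib)
  finally have bound: "(2::nat) ^ (3 * n - 4 * i) * 3 ^ (2 * i - n) = 4 ^ p * 6 ^ r" .
  have "(8/3) ^ n * ((3/2) powi int i * (3/8) powi int i) = ((8/3) ^ n * (9/16) ^ i :: real)"
    by (simp flip: power_mult_distrib)
  also have "\<dots> = ((8/3) ^ 2) ^ p * ((8/3) ^ 3) ^ r * ((9/16) ^ p * ((9/16) ^ 2) ^ r)"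
    by (simp only: n i power_add power_mult)
  also have "\<dots> = ((8/3) ^ 2 * (9/16)) ^ p * ((8/3) ^ 3 * (9/16) ^ 2) ^ r"
    by (simp only: power_mult_distrib mult_ac)
  also have "\<dots> = 4 ^ p * 6 ^ r"
    by (simp add: power2_eq_square power3_eq_cube)
  finally have middle: "(8/3) ^ n * ((3/2) powi int i * (3/8) powi int i) = (4 ^ p * 6 ^ r :: real)" .
  have lower: "4 ^ p * 6 ^ r \<le> card (hamming_support n 3 f)"
    if "f \<in> hamming_eigenspace n 3 i" "\<exists>x\<in>hamming_verts n 3. f x \<noteq> 0" for f
  proof -
    have "real (4 ^ p * 6 ^ r) \<le> real (card (hamming_support n 3 f))"
      using support_bound_middle[OF eigenspace_imp_band[OF that(1)] that(2)] middle by simp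
    then show ?thesis by (simp only: of_nat_le_iff)
  qed
  obtain g where g: "g \<in> hamming_eigenspace n 3 i" "card (hamming_support n 3 g) = 4 ^ p * 6 ^ r"
    using exists_tensor_eigenfunction[of p r] unfolding n[symmetric] i[symmetric] by blast
  have "hamming_support n 3 g \<noteq> {}"
    using g(2) by force
  then have "\<exists>x\<in>hamming_verts n 3. g x \<noteq> 0"
    by (auto simp: hamming_support_def)
  then show ?thesis
    unfolding bound using lower g by blast
qed

end
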